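(* There exist constants $\alpha,\eta>0$ such that for every positive integer $n$ there is a partition of $S^n$ into two subsets $R$ and $B$ such that $R_\eta$ does not contain the unit sphere of any linear subspace of $\mathbb{R}^{n+1}$ of codimension less than $\lfloor\alpha n\rfloor$, and $B_\eta$ does not contain the unit sphere of any $2$-dimensional linear subspace of $\mathbb{R}^{n+1}$.
   Context: $S^n$ is the Euclidean unit sphere of $\mathbb{R}^{n+1}$. For $A\subset S^n$ and $\eta>0$, $A_\eta$ is the set of all points of $S^n$ at (Euclidean) distance at most $\eta$ from $A$. The unit sphere of a subspace $V$ is $V\cap S^n$. *)

theory Defs
  imports "HOL-Analysis.Analysis" "HOL-Library.Function_Algebras"
begin

text \<open>
  The dimension of the sphere varies inside the statement, so \<open>\<real>\<^sup>d\<close> is the library's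
  \<^const>\<open>Euclidean_space\<close>: sequences \<open>nat \<Rightarrow> real\<close> vanishing from index \<open>d\<close> on. The pointwise
  vector space structure below makes the library's \<^const>\<open>subspace\<close> and \<^const>\<open>dim\<close>
  applicable to them.
\<close>

instantiation "fun" :: (type, real_vector) real_vector
begin

definition scaleR_fun :: "real \<Rightarrow> ('a \<Rightarrow> 'b) \<Rightarrow> 'a \<Rightarrow> 'b"
  where "scaleR_fun c f = (\<lambda>x. c *\<^sub>R f x)"

instance
  by standard (simp_all add: scaleR_fun_def fun_eq_iff scaleR_add_right scaleR_add_left)

end

definition linear_subspace :: "nat \<Rightarrow> (nat \<Rightarrow> real) set \<Rightarrow> bool"
  where "linear_subspace d V \<longleftrightarrow> V \<subseteq> topspace (Euclidean_space d) \<and> subspace V"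

definition codimension :: "nat \<Rightarrow> (nat \<Rightarrow> real) set \<Rightarrow> int"
  where "codimension d V = int d - int (dim V)"

text \<open>\<^const>\<open>nsphere\<close> \<open>n\<close> is the unit sphere of \<open>\<real>\<^sup>n\<^sup>+\<^sup>1\<close>, with coordinates \<open>0, \<dots>, n\<close>.\<close>

definition unit_sphere :: "nat \<Rightarrow> (nat \<Rightarrow> real) set"
  where "unit_sphere n = topspace (nsphere n)"

text \<open>
  The Euclidean distance in \<open>\<real>\<^sup>d\<close>. The library's \<^const>\<open>dist\<close> on \<open>nat \<Rightarrow> real\<close> is a different
  metric, inducing the product topology.
\<close>

definition euclidean_dist :: "nat \<Rightarrow> (nat \<Rightarrow> real) \<Rightarrow> (nat \<Rightarrow> real) \<Rightarrow> real"
  where "euclidean_dist d x y = L2_set (\<lambda>i. x i - y i) {..<d}"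

text \<open>
  The distance from a point to a set is an infimum. The distance to the empty set is infinite,
  so its neighbourhood is empty; the nonemptiness condition is needed because the infimum of
  the empty set of reals is unspecified.
\<close>

definition sphere_nbhd :: "nat \<Rightarrow> real \<Rightarrow> (nat \<Rightarrow> real) set \<Rightarrow> (nat \<Rightarrow> real) set"
  where "sphere_nbhd n \<eta> A =
    {x \<in> unit_sphere n. A \<noteq> {} \<and> (INF a\<in>A. euclidean_dist (Suc n) x a) \<le> \<eta>}"

lemma unit_sphere_eq:
  "unit_sphere n = {x \<in> topspace (Euclidean_space (Suc n)). euclidean_dist (Suc n) x 0 = 1}"
  by (auto simp: unit_sphere_def nsphere topspace_Euclidean_space euclidean_dist_def L2_set_def
      lessThan_Suc_atMost)

lemma dim_Euclidean_space: "dim (topspace (Euclidean_space d)) = d"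
proof -
  define e :: "nat \<Rightarrow> nat \<Rightarrow> real" where "e i = (\<lambda>j. if j = i then 1 else 0)" for i
  have sum_app: "(sum g A) x = (\<Sum>a\<in>A. g a x)" for g :: "nat \<Rightarrow> nat \<Rightarrow> real" and A x
    by (induction A rule: infinite_finite_induct) auto
  have inj: "inj_on e {..<d}"
    by (rule inj_onI) (metis e_def zero_neq_one)
  have comb: "(\<Sum>i<d. c i *\<^sub>R e i) = (\<lambda>j. if j < d then c j else 0)" for c
    by (rule ext) (simp add: sum_app scaleR_fun_def e_def if_distrib cong: if_cong)
  have "independent (e ` {..<d})"
    unfolding dependent_finite[OF finite_imageI[OF finite_lessThan]]
  proof safe
    fix u i
    assume z: "(\<Sum>v\<in>e ` {..<d}. u v *\<^sub>R v) = 0" and i: "i < d" and ne: "u (e i) \<noteq> 0"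
    have "(\<lambda>j. if j < d then u (e j) else 0) = (0 :: nat \<Rightarrow> real)"
      using z comb[of "\<lambda>i. u (e i)"] by (simp add: sum.reindex[OF inj])
    from fun_cong[OF this, of i] i ne show False by simp
  qed
  moreover have "e ` {..<d} \<subseteq> topspace (Euclidean_space d)"
    by (auto simp: e_def topspace_Euclidean_space)
  moreover have "topspace (Euclidean_space d) \<subseteq> span (e ` {..<d})"
  proof
    fix x assume "x \<in> topspace (Euclidean_space d)"
    then have "x = (\<Sum>i<d. x i *\<^sub>R e i)"
      unfolding comb by (auto simp: topspace_Euclidean_space fun_eq_iff)
    also have "\<dots> \<in> span (e ` {..<d})"
      by (intro span_sum span_scale span_base) auto
    finally show "x \<in> span (e ` {..<d})" .
  qed
  ultimately have "dim (topspace (Euclidean_space d)) = card (e ` {..<d})"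
    by (metis dim_unique)
  then show ?thesis
    by (simp add: card_image[OF inj])
qed

end

(*
  Write N = n + 1 and colour x in S^n by the size of |x|_1 / sqrt N, which is 1-Lipschitz for the
  Euclidean distance: B is the set where it is at least 15/16.
  A subspace of dimension m contains a point of the cube [-1,1]^N having m coordinates of modulus 1
  (an extreme point of its section of the cube); after normalisation the ratio is at least m / N
  there, which exceeds the threshold when the codimension is small. On the other hand, if x, y are
  orthonormal, then averaging |.|_1 over x, y, (x + y) / sqrt 2, (x - y) / sqrt 2 shows that the
  ratio falls to about 0.924 somewhere on the circle through x and y.
*)
theory Submission
  imports Defs
begin

text \<open>Sums over \<open>{..<Suc n}\<close> must stay whole, so that facts about
  \<open>{..<d}\<close> match them.\<close>

declare sum.lessThan_Suc [simp del]

section \<open>Linear algebra: vectors vanishing at prescribed coordinates, and cube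
  sections\<close>

lemma span_vanishing_on:
  fixes S :: "('a \<Rightarrow> real) set"
  assumes S: "independent S" and A: "finite A" and card: "card A < card S"
  shows "\<exists>y\<in>span S. y \<noteq> 0 \<and> (\<forall>i\<in>A. y i = 0)"
proof (rule ccontr)
  assume no: "\<not> ?thesis"
  \<comment> \<open>Dimension count: \<open>T\<close> restricts to the coordinates in
    \<open>A\<close>. If only 0 vanished on \<open>A\<close>, then \<open>T\<close> would be
    injective on \<open>span S\<close> and carry \<open>S\<close> to an independent set of
    \<open>card S\<close> vectors in the span of the \<open>card A\<close> unit vectors
    \<open>e i\<close>.\<close>
  define T :: "('a \<Rightarrow> real) \<Rightarrow> 'a \<Rightarrow> real" where "T v = (\<lambda>i. if i \<in> A then v i else 0)" for v
  define e :: "'a \<Rightarrow> 'a \<Rightarrow> real" where "e i = (\<lambda>j. if j = i then 1 else 0)" for i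
  have lin: "linear T"
    by (rule linearI) (auto simp: T_def scaleR_fun_def fun_eq_iff)
  have inj: "inj_on T (span S)"
    unfolding linear_inj_on_iff_eq_0[OF lin subspace_span]
  proof (intro ballI impI)
    fix v assume v: "v \<in> span S" and "T v = 0"
    from \<open>T v = 0\<close> have "v i = 0" if "i \<in> A" for i
      using that by (auto simp: T_def fun_eq_iff split: if_splits)
    with v no show "v = 0" by blast
  qed
  have sum_app: "(sum g I) x = (\<Sum>a\<in>I. g a x)" for g :: "'a \<Rightarrow> 'a \<Rightarrow> real" and I x
    by (induction I rule: infinite_finite_induct) auto
  have "T v \<in> span (e ` A)" for v
  proof -
    have "T v = (\<Sum>i\<in>A. v i *\<^sub>R e i)"
      using A by (auto simp: fun_eq_iff sum_app T_def scaleR_fun_def e_def if_distrib cong: if_cong)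
    also have "\<dots> \<in> span (e ` A)"
      by (intro span_sum span_scale span_base) auto
    finally show ?thesis .
  qed
  then have "T ` S \<subseteq> span (e ` A)" by blast
  moreover have "independent (T ` S)"
    using linear_independent_injective_image[OF lin S inj] .
  ultimately have "card (T ` S) \<le> card (e ` A)"
    using independent_span_bound A by blast
  also have "\<dots> \<le> card A"
    by (rule card_image_le[OF A])
  finally show False
    using card card_image[OF inj_on_subset[OF inj span_superset]] by simp
qed

lemma subspace_vanishing_on:
  fixes V :: "('a \<Rightarrow> real) set"
  assumes "subspace V" "finite A" "card A < dim V"
  shows "\<exists>y\<in>V. y \<noteq> 0 \<and> (\<forall>i\<in>A. y i = 0)"
proof -
  obtain S where "S \<subseteq> V" "independent S" "V \<subseteq> span S" "card S = dim V"
    using basis_exists by blast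
  then show ?thesis
    using span_vanishing_on[of S A] span_minimal[of S V] assms by auto
qed

lemma linear_subspace_nonzero_coordinate:
  assumes "linear_subspace d V" "y \<in> V" "y \<noteq> 0"
  shows "\<exists>i<d. y i \<noteq> 0"
proof (rule ccontr)
  assume "\<not> ?thesis"
  moreover have "y i = 0" if "i \<ge> d" for i
    using assms that by (auto simp: linear_subspace_def topspace_Euclidean_space)
  ultimately have "y i = 0" for i
    using not_less by blast
  then have "y = 0" by (simp add: fun_eq_iff)
  with assms show False by blast
qed

lemma linear_subspace_L2_set_pos:
  assumes "linear_subspace d V" "y \<in> V" "y \<noteq> 0"
  shows "L2_set y {..<d} > 0"
proof -
  have "L2_set y {..<d} \<noteq> 0"
    using linear_subspace_nonzero_coordinate[OF assms] by (auto simp: L2_set_eq_0_iff)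
  then show ?thesis
    using L2_set_nonneg[of y "{..<d}"] by linarith
qed

text \<open>Walk towards an extreme point of the cube section. While fewer than \<open>dim V\<close>
  coordinates have modulus 1, some nonzero direction in \<open>V\<close> vanishes at all of them;
  moving along it keeps them fixed until a new coordinate reaches modulus 1.\<close>

lemma exists_many_extremal_coordinates:
  assumes V: "linear_subspace d V"
  shows "m \<le> dim V \<Longrightarrow> \<exists>x\<in>V. (\<forall>i<d. \<bar>x i\<bar> \<le> 1) \<and> m \<le> card {i. i < d \<and> \<bar>x i\<bar> = 1}"
proof (induction m)
  case 0
  have "0 \<in> V"
    using V by (simp add: linear_subspace_def subspace_0)
  then show ?case by force
next
  case (Suc m)
  then obtain x where x: "x \<in> V" "\<forall>i<d. \<bar>x i\<bar> \<le> 1" "m \<le> card {i. i < d \<and> \<bar>x i\<bar> = 1}"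
    by auto
  define A where "A = {i. i < d \<and> \<bar>x i\<bar> = 1}"
  show ?case
  proof (cases "Suc m \<le> card A")
    case True
    with x show ?thesis by (auto simp: A_def)
  next
    case False
    have sub: "subspace V" using V by (simp add: linear_subspace_def)
    have finA: "finite A" by (simp add: A_def)
    from False x Suc.prems have "card A < dim V" by (simp add: A_def)
    then obtain y where y: "y \<in> V" "y \<noteq> 0" "\<forall>i\<in>A. y i = 0"
      using subspace_vanishing_on[OF sub finA] by blast
    define J where "J = {i. i < d \<and> y i \<noteq> 0}"
    \<comment> \<open>For \<open>y i\<close> nonzero, \<open>sgn (y i)\<close> times coordinate i of
      \<open>x + t *\<^sub>R y\<close> is \<open>sgn (y i) * x i + t * \<bar>y i\<bar>\<close>. It
      increases in \<open>t\<close>, so for \<open>t\<close> at least 0 it can leave [-1,1] only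
      through 1, at time \<open>r i\<close>. The minimum of these times is the first exit from the
      cube.\<close>
    define r where "r i = (1 - sgn (y i) * x i) / \<bar>y i\<bar>" for i
    define t where "t = Min (r ` J)"
    have J: "finite J" "J \<noteq> {}"
      using linear_subspace_nonzero_coordinate[OF V y(1,2)] by (auto simp: J_def)
    have "t \<in> r ` J" unfolding t_def using J by (intro Min_in) auto
    then obtain j where j: "j \<in> J" "t = r j" by blast
    have t_le: "t \<le> r i" if "i \<in> J" for i
      unfolding t_def using J that by (intro Min_le) auto
    have sx: "\<bar>sgn (y i) * x i\<bar> \<le> 1" if "i < d" for i
      using x(2) that by (auto simp: abs_mult sgn_if)
    have t0: "t \<ge> 0"
      using j sx[of j] by (auto simp: r_def J_def abs_le_iff intro!: divide_nonneg_nonneg)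
    define z where "z = x + t *\<^sub>R y"
    have zi: "z i = x i + t * y i" for i
      by (simp add: z_def scaleR_fun_def)
    have abs_z: "\<bar>z i\<bar> = \<bar>sgn (y i) * x i + t * \<bar>y i\<bar>\<bar>" if "i \<in> J" for i
      using that by (auto simp: zi J_def sgn_if abs_if)
    have "z \<in> V"
      unfolding z_def using x y sub by (simp add: subspace_add subspace_scale)
    moreover have "\<bar>z i\<bar> \<le> 1" if i: "i < d" for i
    proof (cases "i \<in> J")
      case True
      then have "t * \<bar>y i\<bar> \<le> 1 - sgn (y i) * x i"
        using t_le[of i] by (auto simp: r_def J_def pos_le_divide_eq)
      moreover have "t * \<bar>y i\<bar> \<ge> 0" using t0 by simp
      ultimately show ?thesis
        using sx[OF i] abs_z[OF True] by (auto simp: abs_le_iff)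
    next
      case False
      then show ?thesis using x i by (auto simp: J_def zi)
    qed
    moreover have "Suc m \<le> card {i. i < d \<and> \<bar>z i\<bar> = 1}"
    proof -
      have "t * \<bar>y j\<bar> = 1 - sgn (y j) * x j"
        using j by (auto simp: r_def J_def)
      then have "\<bar>z j\<bar> = 1" using abs_z[of j] j by simp
      moreover have "\<bar>z i\<bar> = 1" if "i \<in> A" for i
        using that y by (simp add: zi A_def)
      ultimately have "insert j A \<subseteq> {i. i < d \<and> \<bar>z i\<bar> = 1}"
        using j by (auto simp: J_def A_def)
      then have "card (insert j A) \<le> card {i. i < d \<and> \<bar>z i\<bar> = 1}"
        by (intro card_mono) auto
      moreover have "j \<notin> A" using j y by (auto simp: J_def)
      ultimately show ?thesis
        using x finA by (simp add: A_def)
    qed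
    ultimately show ?thesis by blast
  qed
qed

section \<open>The l1 norm on the sphere: Lipschitz bound and large values\<close>

lemma sum_abs_le_sqrt_L2_set: "(\<Sum>i<d. \<bar>x i\<bar>) \<le> sqrt (real d) * L2_set x {..<d}"
  using L2_set_mult_ineq[where A = "{..<d}" and f = x and g = "\<lambda>_. 1"] by (simp add: L2_set_constant mult.commute)

text \<open>The Lipschitz constant is the Euclidean norm of the all-ones vector, by Cauchy-Schwarz.
  Exchanging \<open>x\<close> and \<open>a\<close> gives the two-sided bound.\<close>

lemma sum_abs_diff_le_euclidean_dist:
  "(\<Sum>i<d. \<bar>x i\<bar>) - (\<Sum>i<d. \<bar>a i\<bar>) \<le> sqrt (real d) * euclidean_dist d x a"
proof -
  have "(\<Sum>i<d. \<bar>x i\<bar>) - (\<Sum>i<d. \<bar>a i\<bar>) \<le> (\<Sum>i<d. \<bar>x i - a i\<bar>)"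
    unfolding sum_subtractf[symmetric] by (intro sum_mono) linarith
  also have "\<dots> \<le> sqrt (real d) * euclidean_dist d x a"
    unfolding euclidean_dist_def by (rule sum_abs_le_sqrt_L2_set)
  finally show ?thesis .
qed

lemma euclidean_dist_commute: "euclidean_dist d x y = euclidean_dist d y x"
  by (simp add: euclidean_dist_def L2_set_def power2_commute)

text \<open>The infimum defining the neighbourhood need not be attained, hence the slack
  \<open>\<epsilon>\<close>.\<close>

lemma sphere_nbhd_near:
  assumes "x \<in> sphere_nbhd n \<eta> A" "\<epsilon> > 0"
  shows "\<exists>a\<in>A. euclidean_dist (Suc n) x a < \<eta> + \<epsilon>"
proof -
  have "A \<noteq> {}" "(INF a\<in>A. euclidean_dist (Suc n) x a) < \<eta> + \<epsilon>"
    using assms by (auto simp: sphere_nbhd_def)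
  moreover have "bdd_below (euclidean_dist (Suc n) x ` A)"
    by (intro bdd_belowI[of _ 0]) (auto simp: euclidean_dist_def)
  ultimately show ?thesis
    by (simp add: cINF_less_iff)
qed

lemma unit_sphere_iff:
  "x \<in> unit_sphere n \<longleftrightarrow> x \<in> topspace (Euclidean_space (Suc n)) \<and> L2_set x {..<Suc n} = 1"
  by (simp add: unit_sphere_eq euclidean_dist_def)

lemma L2_set_scaleR: "L2_set (c *\<^sub>R x) A = \<bar>c\<bar> * L2_set x A"
  by (simp add: L2_set_def scaleR_fun_def power_mult_distrib sum_distrib_left[symmetric] real_sqrt_mult)

lemma sum_abs_scaleR: "(\<Sum>i\<in>A. \<bar>(c *\<^sub>R x) i\<bar>) = \<bar>c\<bar> * (\<Sum>i\<in>A. \<bar>x i :: real\<bar>)"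
  by (simp add: scaleR_fun_def abs_mult sum_distrib_left)

lemma linear_subspace_normalize:
  assumes V: "linear_subspace (Suc n) V" and x: "x \<in> V" "x \<noteq> 0"
  shows "inverse (L2_set x {..<Suc n}) *\<^sub>R x \<in> V \<inter> unit_sphere n"
proof -
  have "inverse (L2_set x {..<Suc n}) *\<^sub>R x \<in> V"
    using V x by (simp add: linear_subspace_def subspace_scale)
  moreover have "V \<subseteq> topspace (Euclidean_space (Suc n))"
    using V by (simp add: linear_subspace_def)
  ultimately show ?thesis
    using linear_subspace_L2_set_pos[OF V x] by (auto simp: unit_sphere_iff L2_set_scaleR)
qed

text \<open>Normalise a cube point with \<open>dim V\<close> coordinates of modulus 1: its l1 norm
  is at least \<open>dim V\<close>, and its Euclidean norm at most \<open>sqrt (Suc n)\<close>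
  because all coordinates lie in [-1,1].\<close>

lemma exists_large_sum_abs:
  assumes V: "linear_subspace (Suc n) V" and dim: "dim V > 0"
  shows "\<exists>u \<in> V \<inter> unit_sphere n. real (dim V) / sqrt (Suc n) \<le> (\<Sum>i<Suc n. \<bar>u i\<bar>)"
proof -
  let ?d = "Suc n"
  obtain x where x: "x \<in> V" "\<forall>i<?d. \<bar>x i\<bar> \<le> 1" "dim V \<le> card {i. i < ?d \<and> \<bar>x i\<bar> = 1}"
    using exists_many_extremal_coordinates[OF V order.refl] by blast
  let ?A = "{i. i < ?d \<and> \<bar>x i\<bar> = 1}"
  have "x \<noteq> 0" using x dim by auto
  then have pos: "L2_set x {..<?d} > 0"
    using linear_subspace_L2_set_pos V x by blast
  have "real (dim V) \<le> (\<Sum>i\<in>?A. \<bar>x i\<bar>)" using x by simp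
  also have "\<dots> \<le> (\<Sum>i<?d. \<bar>x i\<bar>)"
    by (intro sum_mono2) auto
  finally have l1: "real (dim V) \<le> (\<Sum>i<?d. \<bar>x i\<bar>)" .
  have "(\<Sum>i<?d. (x i)\<^sup>2) \<le> (\<Sum>i<?d. 1)"
    using x by (intro sum_mono) (simp add: abs_square_le_1)
  then have l2: "L2_set x {..<?d} \<le> sqrt ?d"
    by (simp add: L2_set_def)
  have "real (dim V) / sqrt ?d \<le> (\<Sum>i<?d. \<bar>x i\<bar>) / L2_set x {..<?d}"
    using l1 l2 pos by (intro frac_le) (auto intro: sum_nonneg)
  also have "\<dots> = (\<Sum>i<?d. \<bar>(inverse (L2_set x {..<?d}) *\<^sub>R x) i\<bar>)"
    unfolding sum_abs_scaleR using pos by (simp add: field_simps)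
  finally show ?thesis
    using linear_subspace_normalize[OF V x(1) \<open>x \<noteq> 0\<close>] by blast
qed

section \<open>Small l1 norm on two-dimensional subspaces\<close>

text \<open>
  The weight \<open>7/10\<close> replaces \<open>1 / sqrt 2\<close>, making the bound rational: for \<open>a \<ge> b \<ge> 0\<close> the left-hand
  side is \<open>12/5 a + b\<close>, and \<open>(12/5)\<^sup>2 + 1 = (13/5)\<^sup>2\<close>.
\<close>
lemma four_point_bound:
  fixes a b s :: real
  shows "(\<bar>a\<bar> + \<bar>b\<bar> + 7/10 * (\<bar>a + b\<bar> + \<bar>a - b\<bar>)) * s \<le> 13/10 * (a\<^sup>2 + b\<^sup>2 + s\<^sup>2)"
proof -
  have key: "(12/5 * p + q) * s \<le> 13/10 * (p\<^sup>2 + q\<^sup>2 + s\<^sup>2)" for p q :: real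
  proof -
    \<comment> \<open>Since (12/13)^2 + (5/13)^2 = 1, expanding the squares and multiplying by 13/10
      gives exactly the claim. The free factor \<open>s\<close> linearises the bound, so that it can
      be summed over coordinates.\<close>
    have "0 \<le> (p - 12/13 * s)\<^sup>2 + (q - 5/13 * s)\<^sup>2" by simp
    then show ?thesis by (simp add: power2_eq_square algebra_simps)
  qed
  show ?thesis
  proof (cases "\<bar>a\<bar> \<ge> \<bar>b\<bar>")
    case True
    then have "\<bar>a + b\<bar> + \<bar>a - b\<bar> = 2 * \<bar>a\<bar>" by linarith
    then show ?thesis using key[of "\<bar>a\<bar>" "\<bar>b\<bar>"] by (simp add: algebra_simps)
  next
    case False
    then have "\<bar>a + b\<bar> + \<bar>a - b\<bar> = 2 * \<bar>b\<bar>" by linarith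
    then show ?thesis using key[of "\<bar>b\<bar>" "\<bar>a\<bar>"] by (simp add: algebra_simps)
  qed
qed

lemma exists_orthonormal_pair:
  assumes V: "linear_subspace (Suc n) V" and dim: "dim V = 2"
  shows "\<exists>x \<in> V \<inter> unit_sphere n. \<exists>y \<in> V \<inter> unit_sphere n. (\<Sum>i<Suc n. x i * y i) = 0"
proof -
  have sub: "subspace V" using V by (simp add: linear_subspace_def)
  obtain S where S: "S \<subseteq> V" "independent S" "V \<subseteq> span S" "card S = 2"
    using basis_exists[of V] unfolding dim by blast
  then obtain b c where bc: "S = {b, c}" "b \<noteq> c" by (auto simp: card_2_iff)
  have "0 \<notin> S" using S dependent_zero by blast
  with S bc have b: "b \<in> V" "b \<noteq> 0" by auto
  have c: "c \<in> V" using S bc by auto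
  let ?ip = "\<lambda>u v. \<Sum>i<Suc n. u i * v i :: real"
  \<comment> \<open>Gram-Schmidt: \<open>k *\<^sub>R b\<close> is the orthogonal projection of
    \<open>c\<close> onto \<open>b\<close>. Both vectors are normalised only at the end.\<close>
  define k where "k = ?ip b c / ?ip b b"
  define w where "w = c - k *\<^sub>R b"
  have "?ip b b = (L2_set b {..<Suc n})\<^sup>2"
    by (simp add: L2_set_def power2_eq_square sum_nonneg)
  moreover have "(L2_set b {..<Suc n})\<^sup>2 \<noteq> 0"
    using linear_subspace_L2_set_pos[OF V b] by simp
  ultimately have "?ip b b \<noteq> 0" by argo
  have wV: "w \<in> V" unfolding w_def using b c sub by (simp add: subspace_diff subspace_scale)
  have "w \<noteq> 0"
  proof
    assume "w = 0"
    then have "c \<in> span {b}" by (auto simp: w_def span_singleton)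
    moreover have "independent (insert c {b})"
      using S bc by (simp add: insert_commute)
    ultimately show False
      using bc by (simp only: independent_insert) simp
  qed
  have "?ip b w = ?ip b c - k * ?ip b b"
    unfolding sum_distrib_left sum_subtractf[symmetric]
    by (rule sum.cong) (simp_all add: w_def scaleR_fun_def algebra_simps)
  moreover have "k * ?ip b b = ?ip b c"
    using \<open>?ip b b \<noteq> 0\<close> by (simp add: k_def)
  ultimately have "?ip b w = 0" by argo
  moreover have "?ip (p *\<^sub>R b) (q *\<^sub>R w) = p * q * ?ip b w" for p q
    unfolding sum_distrib_left by (simp add: scaleR_fun_def algebra_simps)
  ultimately have "?ip (p *\<^sub>R b) (q *\<^sub>R w) = 0" for p q
    by simp
  then show ?thesis
    by (intro bexI[OF _ linear_subspace_normalize[OF V b]]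
        bexI[OF _ linear_subspace_normalize[OF V wV \<open>w \<noteq> 0\<close>]])
qed

lemma exists_small_sum_abs:
  assumes V: "linear_subspace (Suc n) V" and dim: "dim V = 2"
  shows "\<exists>u \<in> V \<inter> unit_sphere n. (\<Sum>i<Suc n. \<bar>u i\<bar>) < 93/100 * sqrt (Suc n)"
proof (rule ccontr)
  assume no: "\<not> ?thesis"
  let ?d = "Suc n"
  let ?l1 = "\<lambda>v. \<Sum>i<?d. \<bar>v i :: real\<bar>"
  \<comment> \<open>Homogeneity extends the negated claim from unit vectors to all of
    \<open>V\<close>, so it applies directly to \<open>x + y\<close> and \<open>x - y\<close>, which
    have norm \<open>sqrt 2\<close>.\<close>
  have large: "93/100 * sqrt ?d * L2_set v {..<?d} \<le> ?l1 v" if v: "v \<in> V" for v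
  proof (cases "v = 0")
    case True
    have "L2_set (0 :: nat \<Rightarrow> real) {..<?d} = 0" by (simp add: L2_set_def)
    with True show ?thesis by (simp add: sum_nonneg)
  next
    case False
    define c where "c = inverse (L2_set v {..<?d})"
    have c: "c > 0"
      using linear_subspace_L2_set_pos[OF V v False] by (simp add: c_def)
    have "c *\<^sub>R v \<in> V \<inter> unit_sphere n"
      unfolding c_def by (rule linear_subspace_normalize[OF V v False])
    with no have "93/100 * sqrt ?d \<le> ?l1 (c *\<^sub>R v)"
      by (meson not_less)
    also have "\<dots> = ?l1 v / L2_set v {..<?d}"
      unfolding sum_abs_scaleR using c by (simp add: c_def divide_inverse)
    finally show ?thesis
      using linear_subspace_L2_set_pos[OF V v False] by (simp add: pos_le_divide_eq)
  qed
  have sub: "subspace V" using V by (simp add: linear_subspace_def)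
  obtain x y where x: "x \<in> V" "L2_set x {..<?d} = 1" and y: "y \<in> V" "L2_set y {..<?d} = 1"
    and xy: "(\<Sum>i<?d. x i * y i) = 0"
    using exists_orthonormal_pair[OF V dim] by (auto simp: unit_sphere_iff)
  have sx: "(\<Sum>i<?d. (x i)\<^sup>2) = 1" and sy: "(\<Sum>i<?d. (y i)\<^sup>2) = 1"
    using x y by (simp_all add: L2_set_def)
  have "(\<Sum>i<?d. ((x + y) i)\<^sup>2) = (\<Sum>i<?d. (x i)\<^sup>2 + (y i)\<^sup>2 + 2 * (x i * y i))"
    by (rule sum.cong) (auto simp: power2_sum)
  also have "\<dots> = 2"
    unfolding sum.distrib sum_distrib_left[symmetric] sx sy xy by simp
  finally have plus: "L2_set (x + y) {..<?d} = sqrt 2" by (simp only: L2_set_def)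
  have "(\<Sum>i<?d. ((x - y) i)\<^sup>2) = (\<Sum>i<?d. (x i)\<^sup>2 + (y i)\<^sup>2 - 2 * (x i * y i))"
    by (rule sum.cong) (auto simp: power2_diff)
  also have "\<dots> = 2"
    unfolding sum.distrib sum_subtractf sum_distrib_left[symmetric] sx sy xy by simp
  finally have minus: "L2_set (x - y) {..<?d} = sqrt 2" by (simp only: L2_set_def)
  define r where "r = sqrt (real ?d)"
  have r: "r > 0" "r\<^sup>2 = real ?d" by (simp_all add: r_def)
  define L where "L = ?l1 x + ?l1 y + 7/10 * (?l1 (x + y) + ?l1 (x - y))"
  have "(141/100) \<le> sqrt 2" by (rule real_le_rsqrt) (simp add: power2_eq_square)
  then have sqrt2: "r * (141/100) \<le> r * sqrt 2"
    using r by (intro mult_left_mono) auto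
  \<comment> \<open>With 141/100 as lower bound for \<open>sqrt 2\<close>, the four estimates add up
    to 93/100 * (2 + 7/5 * 141/100) = 3.69582 times \<open>r\<close>.\<close>
  have combine: "369/100 * r < p + q + 7/10 * (u + w)"
    if "93/100 * r * 1 \<le> p" "93/100 * r * 1 \<le> q"
      "93/100 * r * sqrt 2 \<le> u" "93/100 * r * sqrt 2 \<le> w" for p q u w
  proof -
    define k where "k = r * sqrt 2"
    have "93/100 * k \<le> u" "93/100 * k \<le> w" "r * (141/100) \<le> k"
      using that sqrt2 by (simp_all only: k_def mult.assoc)
    with that(1,2) r(1) show ?thesis by argo
  qed
  have lower: "369/100 * r < L"
    unfolding L_def
    using large[OF x(1)] large[OF y(1)] large[OF subspace_add[OF sub x(1) y(1)]]
      large[OF subspace_diff[OF sub x(1) y(1)]]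
    unfolding x(2) y(2) plus minus r_def[symmetric] by (rule combine)
  \<comment> \<open>The best scale would be \<open>sqrt 2 / r\<close>; 7/5 is a rational substitute.
    The resulting upper bound on \<open>L\<close> is 1287/350 * \<open>r\<close>, about 3.677 *
    \<open>r\<close>, below the lower bound 3.69 * \<open>r\<close>.\<close>
  define s where "s = 7/5 / r"
  have "L * s = (\<Sum>i<?d. (\<bar>x i\<bar> + \<bar>y i\<bar> + 7/10 * (\<bar>x i + y i\<bar> + \<bar>x i - y i\<bar>)) * s)"
    unfolding sum_distrib_right[symmetric] sum.distrib sum_distrib_left[symmetric] by (simp add: L_def)
  also have "\<dots> \<le> (\<Sum>i<?d. 13/10 * ((x i)\<^sup>2 + (y i)\<^sup>2 + s\<^sup>2))"
    by (intro sum_mono four_point_bound)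
  also have "\<dots> = 13/10 * (2 + real ?d * s\<^sup>2)"
    unfolding sum_distrib_left[symmetric] sum.distrib sx sy by simp
  also have "real ?d * s\<^sup>2 = 49/25"
    unfolding r(2)[symmetric] using r(1) by (simp add: s_def power_divide)
  finally have "L * 7/5 \<le> 1287/250 * r"
    using r by (simp add: s_def field_simps)
  with lower r(1) show False by linarith
qed

section \<open>The colouring by the normalised l1 norm\<close>

theorem corollary1p6:
  shows "\<exists>\<alpha> \<eta> :: real. \<alpha> > 0 \<and> \<eta> > 0 \<and>
    (\<forall>n :: nat. n \<ge> 1 \<longrightarrow>
      (\<exists>R B. R \<union> B = unit_sphere n \<and> R \<inter> B = {} \<and>
        (\<forall>V. linear_subspace (Suc n) V \<and> codimension (Suc n) V < \<lfloor>\<alpha> * real n\<rfloor> \<longrightarrow>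
             \<not> V \<inter> unit_sphere n \<subseteq> sphere_nbhd n \<eta> R) \<and>
        (\<forall>V. linear_subspace (Suc n) V \<and> dim V = 2 \<longrightarrow>
             \<not> V \<inter> unit_sphere n \<subseteq> sphere_nbhd n \<eta> B)))"
\<comment> \<open>In units of \<open>r\<close>, codimension below \<open>n\<close>/20 forces an l1
  norm above 19/20 = 0.95, every plane has a unit vector below 0.93, and the threshold 15/16 =
  0.9375 lies between. Both gaps, 0.0125 and 0.0075, exceed 3/500, which is the radius 1/200 plus a
  slack of 1/1000 for the infimum.\<close>
proof (rule exI[of _ "1/20"], rule exI[of _ "1/200"], intro conjI allI impI)
  fix n :: nat
  let ?l1 = "\<lambda>v. \<Sum>i<Suc n. \<bar>v i :: real\<bar>"
  define r where "r = sqrt (real (Suc n))"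
  have r: "r > 0" "r * r = real (Suc n)" by (simp_all add: r_def)
  define B where "B = {x \<in> unit_sphere n. ?l1 x \<ge> 15/16 * r}"
  define R where "R = unit_sphere n - B"
  have near: "\<exists>a\<in>A. \<bar>?l1 x - ?l1 a\<bar> \<le> r * (3/500)" if "x \<in> sphere_nbhd n (1/200) A" for x A
  proof -
    from that obtain a where a: "a \<in> A" "euclidean_dist (Suc n) x a < 3/500"
      using sphere_nbhd_near[of x n "1/200" A "1/1000"] by auto
    have "\<bar>?l1 x - ?l1 a\<bar> \<le> r * euclidean_dist (Suc n) x a"
      using sum_abs_diff_le_euclidean_dist[of x "Suc n" a]
        sum_abs_diff_le_euclidean_dist[of a "Suc n" x]
      unfolding r_def abs_le_iff minus_diff_eq euclidean_dist_commute[of _ a x] by blast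
    also have "\<dots> \<le> r * (3/500)"
      using a r by (intro mult_left_mono) auto
    finally show ?thesis using a by blast
  qed
  show "\<exists>R B. R \<union> B = unit_sphere n \<and> R \<inter> B = {} \<and>
        (\<forall>V. linear_subspace (Suc n) V \<and> codimension (Suc n) V < \<lfloor>1/20 * real n\<rfloor> \<longrightarrow>
             \<not> V \<inter> unit_sphere n \<subseteq> sphere_nbhd n (1/200) R) \<and>
        (\<forall>V. linear_subspace (Suc n) V \<and> dim V = 2 \<longrightarrow>
             \<not> V \<inter> unit_sphere n \<subseteq> sphere_nbhd n (1/200) B)"
  proof (rule exI[of _ R], rule exI[of _ B], intro conjI allI impI notI)
    show "R \<union> B = unit_sphere n" "R \<inter> B = {}" by (auto simp: R_def B_def)
  next
    fix V
    assume V: "linear_subspace (Suc n) V \<and> codimension (Suc n) V < \<lfloor>1/20 * real n\<rfloor>"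
      and sub: "V \<inter> unit_sphere n \<subseteq> sphere_nbhd n (1/200) R"
    \<comment> \<open>This gives \<open>dim V\<close> > \<open>n\<close> + 1 - \<open>n\<close>/20,
      which is more than 19/20 of \<open>n\<close> + 1.\<close>
    then have "real (Suc n) - real (dim V) < 1/20 * real n"
      unfolding codimension_def less_floor_iff by linarith
    then have big: "19/20 * (r * r) < real (dim V)"
      unfolding r by simp
    then have "dim V > 0" using r by (intro gr0I) auto
    then obtain u where u: "u \<in> V \<inter> unit_sphere n" "real (dim V) / r \<le> ?l1 u"
      using exists_large_sum_abs V unfolding r_def by blast
    have "19/20 * r < real (dim V) / r"
      using big r by (simp add: pos_less_divide_eq)
    with u have lu: "19/20 * r < ?l1 u" by linarith
    obtain a where "a \<in> R" "\<bar>?l1 u - ?l1 a\<bar> \<le> r * (3/500)"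
      using near u sub by blast
    moreover from \<open>a \<in> R\<close> have "?l1 a < 15/16 * r" by (auto simp: R_def B_def)
    ultimately show False using lu r(1) by linarith
  next
    fix V
    assume V: "linear_subspace (Suc n) V \<and> dim V = 2"
      and sub: "V \<inter> unit_sphere n \<subseteq> sphere_nbhd n (1/200) B"
    then obtain u where u: "u \<in> V \<inter> unit_sphere n" "?l1 u < 93/100 * r"
      using exists_small_sum_abs unfolding r_def by blast
    obtain a where "a \<in> B" "\<bar>?l1 u - ?l1 a\<bar> \<le> r * (3/500)"
      using near u sub by blast
    moreover from \<open>a \<in> B\<close> have "15/16 * r \<le> ?l1 a" by (auto simp: B_def)
    ultimately show False using u r(1) by linarith
  qed
qed auto

end
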